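(* For all integers $n\ge k\ge 1$, the Ward-Lah numbers $W(n,k)$ satisfy $$W(n,k)=2(n+k-1)\,W(n-1,k-1)+(n+2k-1)\,W(n-1,k).$$
   Context: Partition transformation: for integers $n,k\ge 0$ and a sequence $a_1,a_2,\dots$, $$P_n^k(a_1,a_2,\dots)=\sum_{q}(-1)^{q_0}\prod_{j=0}^{\ell(q)-1}\binom{q_j}{q_{j+1}}a_{j+1}^{q_j},$$ where the sum is over integer partitions $q=(q_0\ge q_1\ge\dots)$ of $n=q_0+q_1+\cdots$ with $q_0=k$; $\ell(q)$ is the length of $q$ (number of positive parts), so $q_{\ell(q)-1}>0$ and $q_{\ell(q)}=0$. Falling factorial: $x^{\underline{n}}=\prod_{i=0}^{n-1}(x-i)$. Ward-Lah numbers: for integers $n\ge k\ge 0$, $W(n,k)=(-1)^k (n+k)^{\underline{n}}\,P_n^k(1,1,\dots)$ (all $a_i=1$), with $W(0,0)=1$, $W(n,0)=0$ for $n\ge 1$, $W(0,k)=0$ for $k\ge 1$, and $W(n,k)=0$ for $k>n$. *)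

theory Defs
  imports Complex_Main
begin

text \<open>
  An integer partition of \<open>n\<close> is an infinite weakly decreasing sequence of
  naturals, indexed from \<open>0\<close>, with finitely many nonzero entries (the parts), summing to \<open>n\<close>.
  In particular \<open>0\<close> has exactly one partition, the zero sequence, whose entry at \<open>0\<close> is \<open>0\<close>.
\<close>

definition is_partition :: "(nat \<Rightarrow> nat) \<Rightarrow> nat \<Rightarrow> bool" where
  "is_partition q n \<longleftrightarrow> antimono q \<and> finite {j. q j > 0} \<and> (\<Sum>j | q j > 0. q j) = n"

definition part_length :: "(nat \<Rightarrow> nat) \<Rightarrow> nat" where
  "part_length q = card {j. q j > 0}"

text \<open>The sequence \<open>a\<close> is used from index \<open>1\<close> on; its value at \<open>0\<close> is irrelevant.\<close>

definition partition_transform :: "nat \<Rightarrow> nat \<Rightarrow> (nat \<Rightarrow> 'a::comm_ring_1) \<Rightarrow> 'a" where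
  "partition_transform n k a =
     (\<Sum>q | is_partition q n \<and> q 0 = k.
        (-1) ^ q 0 * (\<Prod>j<part_length q. of_nat (q j choose q (j + 1)) * a (j + 1) ^ q j))"

definition falling_factorial :: "'a::comm_ring_1 \<Rightarrow> nat \<Rightarrow> 'a" where
  "falling_factorial x n = (\<Prod>i<n. x - of_nat i)"

definition ward_lah :: "nat \<Rightarrow> nat \<Rightarrow> int" where
  "ward_lah n k =
     (if k \<le> n then (-1) ^ k * falling_factorial (int n + int k) n * partition_transform n k (\<lambda>_. 1)
      else 0)"

lemma partition_support:
  assumes "is_partition q n" "q j > 0"
  shows "j < n"
proof -
  let ?S = "{i. q i > 0}"
  from assms(1) have anti: "antimono q" and fin: "finite ?S" and s: "sum q ?S = n"
    by (auto simp: is_partition_def)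
  have "{..j} \<subseteq> ?S"
    using anti assms(2) by (auto dest: antimonoD intro: less_le_trans)
  then have "card {..j} \<le> card ?S"
    using fin by (rule card_mono[rotated])
  also have "card ?S = (\<Sum>i\<in>?S. 1)" by simp
  also have "\<dots> \<le> sum q ?S" by (rule sum_mono) auto
  finally show ?thesis using s by simp
qed

lemma partition_entry_le:
  assumes "is_partition q n"
  shows "q j \<le> n"
proof (cases "q j > 0")
  case True
  then have "q j \<le> sum q {i. q i > 0}"
    using assms by (intro member_le_sum) (auto simp: is_partition_def)
  then show ?thesis using assms by (simp add: is_partition_def)
qed simp

text \<open>The sum defining \<^const>\<open>partition_transform\<close> is finite.\<close>

lemma finite_partitions: "finite {q. is_partition q n \<and> q 0 = k}"
proof (rule finite_subset)
  show "{q. is_partition q n \<and> q 0 = k} \<subseteq>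
      {f. \<forall>x. (x \<in> {..<n} \<longrightarrow> f x \<in> {..n}) \<and> (x \<notin> {..<n} \<longrightarrow> f x = 0)}"
    using partition_support partition_entry_le by fastforce
  show "finite {f::nat \<Rightarrow> nat. \<forall>x. (x \<in> {..<n} \<longrightarrow> f x \<in> {..n}) \<and> (x \<notin> {..<n} \<longrightarrow> f x = 0)}"
    by (rule finite_set_of_finite_funs) auto
qed

text \<open>The boundary conventions hold for the definition of \<^const>\<open>ward_lah\<close>.\<close>

lemma partitions_first_zero:
  "{q. is_partition q n \<and> q 0 = 0} = (if n = 0 then {\<lambda>_. 0} else {})"
proof -
  have "q = (\<lambda>_. 0)" if "is_partition q n" "q 0 = 0" for q
    using that antimonoD[of q 0] by (auto simp: is_partition_def fun_eq_iff)
  moreover have "is_partition (\<lambda>_. 0) n \<longleftrightarrow> n = 0"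
    by (auto simp: is_partition_def antimono_def)
  ultimately show ?thesis by (auto split: if_splits)
qed

lemma ward_lah_0_0: "ward_lah 0 0 = 1"
  unfolding ward_lah_def partition_transform_def partitions_first_zero
  by (simp add: falling_factorial_def part_length_def)

lemma ward_lah_n_0: "n \<ge> 1 \<Longrightarrow> ward_lah n 0 = 0"
  unfolding ward_lah_def partition_transform_def partitions_first_zero by simp

lemma ward_lah_0_k: "k \<ge> 1 \<Longrightarrow> ward_lah 0 k = 0"
  by (simp add: ward_lah_def)

lemma ward_lah_gt: "k > n \<Longrightarrow> ward_lah n k = 0"
  by (simp add: ward_lah_def)

end

theory Submission
  imports Defs
begin

text \<open>
  Removing the first part of a partition gives a recurrence for the partition transform. When all
  \<open>a\<^sub>i\<close> are 1, Vandermonde's identity solves it: \<open>P\<close> is, up to sign, the number of compositions of \<open>n\<close>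
  into \<open>k\<close> parts (\<open>q\<^sub>j\<close> counts the parts exceeding \<open>j\<close>). Hence \<open>W(n,k)\<close> is a falling factorial times
  a binomial coefficient, and the claim reduces to Pascal's rule and absorption.
\<close>

lemma support_case_nat:
  "(k::nat) > 0 \<Longrightarrow> {j. case_nat k r j > 0} = insert 0 (Suc ` {j. r j > 0})"
  by (rule set_eqI, rename_tac j, case_tac j) auto

text \<open>\<open>case_nat k r\<close> puts a new first part \<open>k\<close> in front of
  \<open>r\<close>. This is the inverse of removing the first part, the bijection behind the
  recurrence.\<close>

lemma is_partition_case_nat:
  assumes "k > 0"
  shows "is_partition (case_nat k r) (n + k) \<longleftrightarrow> is_partition r n \<and> r 0 \<le> k"
proof -
  note supp = support_case_nat[OF assms, of r]
  have fin: "finite {j. case_nat k r j > 0} \<longleftrightarrow> finite {j. r j > 0}"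
    unfolding supp by (simp add: finite_image_iff)
  have "(\<Sum>j | case_nat k r j > 0. case_nat k r j) = k + (\<Sum>j | r j > 0. r j)"
    if "finite {j. r j > 0}"
    unfolding supp using that by (simp add: sum.reindex)
  moreover have "antimono (case_nat k r) \<longleftrightarrow> antimono r \<and> r 0 \<le> k"
    unfolding antimono_iff_le_Suc by (auto split: nat.split)
  ultimately show ?thesis
    unfolding is_partition_def fin by auto
qed

lemma part_length_case_nat:
  assumes "k > 0" "is_partition r n"
  shows "part_length (case_nat k r) = Suc (part_length r)"
  using assms by (simp add: part_length_def is_partition_def support_case_nat card_image)

lemma partition_transform_0_right:
  "partition_transform n 0 a = (if n = 0 then 1 else 0)"
  unfolding partition_transform_def partitions_first_zero by (simp add: part_length_def)

lemma partition_transform_gt: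
  assumes "k > n"
  shows "partition_transform n k a = 0"
proof -
  have "{q. is_partition q n \<and> q 0 = k} = {}"
    using assms partition_entry_le by (metis (mono_tags, lifting) Collect_empty_eq not_less)
  then show ?thesis
    unfolding partition_transform_def by (simp only: sum.empty)
qed

text \<open>Removing the first part \<open>k\<close> leaves a partition of \<open>n\<close> with
  some first part \<open>i\<close> \<le> \<open>k\<close>. The factor at index 0 becomes the
  coefficient, and the other factors see the sequence shifted by one. The inner
  \<open>(-1) ^ i\<close> cancels the sign inside the smaller transform.\<close>

lemma partition_transform_rec:
  assumes "k > 0"
  shows "partition_transform (n + k) k a =
    (- a 1) ^ k * (\<Sum>i\<le>k. of_nat (k choose i) * ((-1) ^ i * partition_transform n i (\<lambda>j. a (Suc j))))"
proof -
  \<comment> \<open>The weight without its sign; the sign depends only on the first part, so it is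
    constant on each \<open>?A n k\<close>.\<close>
  define w where "w a q = (\<Prod>j<part_length q. of_nat (q j choose q (j + 1)) * a (j + 1) ^ q j)"
    for a :: "nat \<Rightarrow> 'a" and q
  let ?A = "\<lambda>n k. {q. is_partition q n \<and> q 0 = k}"
  let ?b = "\<lambda>j. a (Suc j)"
  have sgn: "(-1) ^ i * partition_transform n i b = (\<Sum>q\<in>?A n i. w b q)" for n i and b :: "nat \<Rightarrow> 'a"
    unfolding partition_transform_def w_def sum_distrib_left
    by (rule sum.cong) (auto simp flip: mult.assoc power_mult_distrib)
  have w: "w a (case_nat k r) = of_nat (k choose r 0) * a 1 ^ k * w ?b r" if "is_partition r n" for r
    unfolding w_def part_length_case_nat[OF assms that] prod.lessThan_Suc_shift by simp
  have "(\<Sum>q\<in>?A (n + k) k. w a q) = (\<Sum>r\<in>(\<Union>i\<le>k. ?A n i). w a (case_nat k r))"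
  proof (rule sum.reindex_bij_witness[where i = "case_nat k" and j = "\<lambda>q j. q (Suc j)"])
    fix q assume "q \<in> ?A (n + k) k"
    then have q: "is_partition q (n + k)" "q 0 = k" by auto
    show eq: "case_nat k (\<lambda>j. q (Suc j)) = q"
      using q(2) by (auto simp: fun_eq_iff split: nat.split)
    show "(\<lambda>j. q (Suc j)) \<in> (\<Union>i\<le>k. ?A n i)"
      using is_partition_case_nat[OF assms, of "\<lambda>j. q (Suc j)" n] q(1) unfolding eq by auto
    show "w a (case_nat k (\<lambda>j. q (Suc j))) = w a q"
      unfolding eq ..
  qed (auto simp: is_partition_case_nat[OF assms])
  also have "\<dots> = (\<Sum>i\<le>k. \<Sum>r\<in>?A n i. w a (case_nat k r))"
    by (rule sum.UNION_disjoint) (use finite_partitions in auto)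
  also have "\<dots> = (\<Sum>i\<le>k. of_nat (k choose i) * a 1 ^ k * (\<Sum>r\<in>?A n i. w ?b r))"
    unfolding sum_distrib_left by (intro sum.cong) (auto simp: w)
  also have "\<dots> = a 1 ^ k * (\<Sum>i\<le>k. of_nat (k choose i) * ((-1) ^ i * partition_transform n i ?b))"
    by (simp add: sgn sum_distrib_left mult_ac)
  finally have "(-1) ^ k * partition_transform (n + k) k a =
      a 1 ^ k * (\<Sum>i\<le>k. of_nat (k choose i) * ((-1) ^ i * partition_transform n i ?b))"
    by (simp only: sgn)
  \<comment> \<open>The sign changes sides by multiplying with it again, which works in any
    commutative ring.\<close>
  then have "((-1) ^ k * (-1) ^ k) * partition_transform (n + k) k a = (-1) ^ k * \<dots>"
    unfolding mult.assoc by (rule arg_cong)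
  moreover have "(-1) ^ k * (-1) ^ k = (1 :: 'a)"
    by (simp flip: power_mult_distrib)
  ultimately have "partition_transform (n + k) k a = (-1) ^ k * (a 1 ^ k *
      (\<Sum>i\<le>k. of_nat (k choose i) * ((-1) ^ i * partition_transform n i ?b)))"
    by (simp only: mult_1)
  then show ?thesis
    unfolding power_minus[of "a 1"] mult.assoc .
qed

text \<open>Vandermonde after reflecting \<open>m choose i\<close> to
  \<open>m choose (m - i)\<close>: the lower indices then add up to \<open>Suc m\<close>.\<close>

lemma sum_choose_mult_choose_Suc:
  "(\<Sum>i\<le>k. (k choose Suc i) * (m choose i)) = (m + k) choose (Suc m)"
proof -
  have "(m + k) choose (Suc m) = (\<Sum>i\<le>Suc m. (k choose i) * (m choose (Suc m - i)))"
    by (simp add: vandermonde add.commute)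
  also have "\<dots> = (\<Sum>i\<le>m. (k choose Suc i) * (m choose (m - i)))"
    by (simp add: sum.atMost_Suc_shift binomial_eq_0 del: sum.atMost_Suc)
  also have "\<dots> = (\<Sum>i\<le>m. (k choose Suc i) * (m choose i))"
    by (intro sum.cong) (auto simp flip: binomial_symmetric)
  \<comment> \<open>Either of \<open>m\<close> and \<open>k\<close> may be larger, so the range
    passes through their maximum; the extra terms vanish.\<close>
  also have "\<dots> = (\<Sum>i\<le>max m k. (k choose Suc i) * (m choose i))"
    by (intro sum.mono_neutral_left) (auto simp: binomial_eq_0)
  also have "\<dots> = (\<Sum>i\<le>k. (k choose Suc i) * (m choose i))"
    by (intro sum.mono_neutral_right) (auto simp: binomial_eq_0)
  finally show ?thesis ..
qed

text \<open>Strong induction, since removing the first part \<open>Suc k\<close> lowers the total by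
  that much. The total left is negative, zero or \<open>Suc m\<close> in the three cases.\<close>

lemma partition_transform_one:
  "partition_transform (Suc n) (Suc k) (\<lambda>_. 1) = (-1) ^ Suc k * (of_nat (n choose k) :: 'a::comm_ring_1)"
proof (induction n arbitrary: k rule: less_induct)
  case (less n)
  let ?P = "\<lambda>n k. partition_transform n k (\<lambda>_. 1) :: 'a"
  consider "n < k" | "n = k" | m where "n = Suc m + k"
    by (metis add.commute add_Suc_right less_imp_Suc_add linorder_neqE_nat)
  then show ?case
  proof cases
    case 1
    then show ?thesis by (simp add: partition_transform_gt binomial_eq_0)
  next
    case 2
    have "(\<Sum>i\<le>Suc k. of_nat (Suc k choose i) * ((-1) ^ i * ?P 0 i)) = 1"
      by (simp add: sum.atMost_Suc_shift partition_transform_0_right partition_transform_gt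
          del: sum.atMost_Suc)
    with 2 show ?thesis
      using partition_transform_rec[of "Suc k" 0 "\<lambda>_. 1 :: 'a"] by simp
  next
    case (3 m)
    have "?P (Suc n) (Suc k) =
        (-1) ^ Suc k * (\<Sum>i\<le>Suc k. of_nat (Suc k choose i) * ((-1) ^ i * ?P (Suc m) i))"
      using partition_transform_rec[of "Suc k" "Suc m" "\<lambda>_. 1 :: 'a"] 3 by simp
    \<comment> \<open>The term for 0 drops out: a positive total has no partition with first entry
      0.\<close>
    also have "(\<Sum>i\<le>Suc k. of_nat (Suc k choose i) * ((-1) ^ i * ?P (Suc m) i)) =
        (\<Sum>i\<le>k. of_nat (Suc k choose Suc i) * ((-1) ^ Suc i * ?P (Suc m) (Suc i)))"
      by (simp add: sum.atMost_Suc_shift partition_transform_0_right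
          del: sum.atMost_Suc binomial_Suc_Suc)
    also have "\<dots> = (\<Sum>i\<le>k. of_nat (Suc k choose Suc i) * of_nat (m choose i))"
      using 3 less.IH[of m] by (simp del: binomial_Suc_Suc flip: mult.assoc power_mult_distrib)
    \<comment> \<open>The added term at \<open>Suc k\<close> is zero; it gives the sum the range of
      the Vandermonde lemma.\<close>
    also have "\<dots> = of_nat (\<Sum>i\<le>Suc k. (Suc k choose Suc i) * (m choose i))"
      by (simp add: binomial_eq_0 del: binomial_Suc_Suc)
    also have "\<dots> = of_nat (n choose k)"
      unfolding sum_choose_mult_choose_Suc
      using 3 binomial_symmetric[of "Suc m" n] by (simp add: add.commute del: binomial_Suc_Suc)
    finally show ?thesis .
  qed
qed

text \<open>The two signs cancel. For \<open>k > n\<close> the binomial coefficient vanishes, so the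
  formula also covers the range where \<open>ward_lah\<close> is 0 by convention.\<close>

lemma ward_lah_Suc_Suc:
  "ward_lah (Suc n) (Suc k) = falling_factorial (int n + int k + 2) (Suc n) * int (n choose k)"
proof (cases "k \<le> n")
  case True
  then have "ward_lah (Suc n) (Suc k) =
      (-1) ^ Suc k * falling_factorial (int n + int k + 2) (Suc n) * ((-1) ^ Suc k * int (n choose k))"
    by (simp only: ward_lah_def partition_transform_one) (simp add: add_ac)
  also have "\<dots> = ((-1) ^ Suc k * (-1) ^ Suc k) *
      (falling_factorial (int n + int k + 2) (Suc n) * int (n choose k))"
    by (simp only: mult_ac)
  finally show ?thesis by (simp flip: power_mult_distrib)
qed (simp add: ward_lah_def binomial_eq_0)

lemma falling_factorial_Suc: "falling_factorial x (Suc n) = falling_factorial x n * (x - of_nat n)"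
  by (simp add: falling_factorial_def)

lemma falling_factorial_Suc_left: "falling_factorial x (Suc n) = x * falling_factorial (x - 1) n"
  unfolding falling_factorial_def prod.lessThan_Suc_shift by (simp add: algebra_simps)

theorem theorem2p7:
  fixes n k :: nat
  assumes "1 \<le> k" and "k \<le> n"
  shows "ward_lah n k =
    2 * (int n + int k - 1) * ward_lah (n - 1) (k - 1)
    + (int n + 2 * int k - 1) * ward_lah (n - 1) k"
proof (cases "n = 1")
  case True
  with assms have "k = 1" by simp
  with True show ?thesis
    using ward_lah_Suc_Suc[of 0 0]
    by (simp add: ward_lah_0_0 ward_lah_0_k falling_factorial_def)
next
  case False
  with assms have "n = Suc (Suc (n - 2))" "k = Suc (k - 1)"
    by auto
  then obtain m j where n: "n = Suc (Suc m)" and k: "k = Suc j"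
    by blast
  \<comment> \<open>The common part of the three falling factorials: \<open>ward_lah n k\<close> has
    two more factors at the top, \<open>ward_lah (n - 1) k\<close> one more at the top, and
    \<open>ward_lah (n - 1) (k - 1)\<close> one more at the bottom.\<close>
  define G where "G = falling_factorial (int m + int j + 1) m"
  have W: "ward_lah n k = (int m + int j + 3) * (int m + int j + 2) * G * int (Suc m choose j)"
    unfolding n k ward_lah_Suc_Suc G_def by (simp add: falling_factorial_Suc_left add_ac)
  have W1: "ward_lah (n - 1) k = (int m + int j + 2) * G * int (m choose j)"
    unfolding n k diff_Suc_1 ward_lah_Suc_Suc G_def
    by (simp add: falling_factorial_Suc_left add_ac)
  show ?thesis
  proof (cases j)
    case 0
    then show ?thesis
      unfolding W W1 using n k by (simp add: ward_lah_n_0)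
  next
    case (Suc i)
    have "falling_factorial (int m + int i + 2) (Suc m) = G * (int i + 2)"
      unfolding G_def Suc by (simp add: falling_factorial_Suc add_ac)
    then have W2: "ward_lah (n - 1) (k - 1) = G * (int i + 2) * int (m choose i)"
      unfolding n k Suc diff_Suc_1 ward_lah_Suc_Suc by simp
    \<comment> \<open>For \<open>i\<close> \<le> \<open>m\<close> both sides equal
      \<open>m * ((m - 1) choose i)\<close>.\<close>
    have absorb: "(int i + 1) * int (m choose Suc i) = (int m - int i) * int (m choose i)"
    proof (cases "i \<le> m")
      case True
      have "Suc i * (m choose Suc i) = (m - i) * (m choose i)"
        by (metis binomial_absorb_comp binomial_absorption)
      then have "int (Suc i * (m choose Suc i)) = int ((m - i) * (m choose i))"
        by (rule arg_cong)
      with True show ?thesis by (simp add: of_nat_diff algebra_simps)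
    qed (simp add: binomial_eq_0)
    \<comment> \<open>The claim divided by \<open>(int m + int i + 3) * G\<close>, with Pascal's
      rule applied on the left. Collecting the coefficients of the two binomials leaves exactly
      \<open>absorb\<close>.\<close>
    have *: "(int m + int i + 4) * (int (m choose i) + int (m choose Suc i)) =
        2 * (int i + 2) * int (m choose i) + (int m + 2 * int i + 5) * int (m choose Suc i)"
      using absorb by (simp add: algebra_simps)
    have "ward_lah n k = (int m + int i + 3) * G *
        ((int m + int i + 4) * (int (m choose i) + int (m choose Suc i)))"
      unfolding W Suc by (simp add: mult_ac add_ac)
    then show ?thesis
      unfolding * W1 W2 unfolding n k Suc by (simp add: algebra_simps)
  qed
qed

end
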